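(* Let $S$ be a numerical semigroup of type $2$. Then $P(S)=2$, where $P(S)$ is the number of numerical sets $T$ with $A(T)=S$.
   Context: A numerical set $T$ is a subset of $\mathbb{N}_0=\{0,1,2,\dots\}$ containing $0$ with finite complement. A numerical semigroup is a numerical set closed under addition. The atom monoid of $T$ is $A(T)=\{x\in\mathbb{N}_0 \mid x+T\subseteq T\}$. The pseudo-Frobenius numbers of $S$ are $PF(S)=\{P\in \mathbb{N}_0\setminus S \mid P+s\in S \text{ for all } s\in S\setminus\{0\}\}$, and the type of $S$ is $t(S)=|PF(S)|$. *)

theory Defs
  imports Main
begin

definition numerical_set :: "nat set \<Rightarrow> bool" where
  "numerical_set T \<longleftrightarrow> 0 \<in> T \<and> finite (- T)"

definition numerical_semigroup :: "nat set \<Rightarrow> bool" where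
  "numerical_semigroup S \<longleftrightarrow> numerical_set S \<and> (\<forall>x\<in>S. \<forall>y\<in>S. x + y \<in> S)"

definition atom_monoid :: "nat set \<Rightarrow> nat set" where
  "atom_monoid T = {x. (\<lambda>t. x + t) ` T \<subseteq> T}"

definition pseudo_frobenius :: "nat set \<Rightarrow> nat set" where
  "pseudo_frobenius S = {p. p \<notin> S \<and> (\<forall>s\<in>S - {0}. p + s \<in> S)}"

definition semigroup_type :: "nat set \<Rightarrow> nat" where
  "semigroup_type S = card (pseudo_frobenius S)"

definition associated_numerical_sets :: "nat set \<Rightarrow> nat set set" where
  "associated_numerical_sets S = {T. numerical_set T \<and> atom_monoid T = S}"

definition num_associated_sets :: "nat set \<Rightarrow> nat" where
  "num_associated_sets S = card (associated_numerical_sets S)"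

end

theory Submission imports Defs begin

text \<open>
  Let \<open>F\<close> be the largest gap of \<open>S\<close>, let \<open>PF(S) = {P, F}\<close>, and let \<open>K = {x. F - x \<notin> S}\<close> be the
  canonical ideal. Both \<open>S\<close> and \<open>K\<close> have atom monoid \<open>S\<close>, and \<open>P \<in> K - S\<close>. If \<open>A(T) = S\<close>, then \<open>T\<close>
  is an \<open>S\<close>-module with \<open>S \<subseteq> T \<subseteq> K\<close>. Every gap can be moved into \<open>PF(S)\<close> by adding an element of
  \<open>S\<close>, so if \<open>T \<noteq> S\<close> then \<open>P \<in> T\<close>. As \<open>P \<notin> A(T)\<close>, some \<open>t \<in> T\<close> has \<open>P + t \<notin> T\<close>, and moving the gap
  \<open>P + t\<close> up to \<open>F\<close> yields \<open>F - P \<in> T\<close>. But \<open>0\<close> and \<open>F - P\<close> generate \<open>K\<close> over \<open>S\<close>, whence \<open>T = K\<close>.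
\<close>

lemma atom_monoid_iff: "x \<in> atom_monoid T \<longleftrightarrow> (\<forall>t\<in>T. x + t \<in> T)"
  by (auto simp: atom_monoid_def)

lemma atom_monoid_semigroup:
  assumes "numerical_semigroup S"
  shows "atom_monoid S = S"
proof -
  have "0 \<in> S" and "\<forall>x\<in>S. \<forall>y\<in>S. x + y \<in> S"
    using assms by (auto simp: numerical_semigroup_def numerical_set_def)
  then show ?thesis by (force simp: atom_monoid_iff)
qed

text \<open>Only finitely many \<open>s\<close> in \<open>S\<close> keep \<open>x + s\<close> a gap.
  For the largest of them, adding any further nonzero element of \<open>S\<close> lands in
  \<open>S\<close>.\<close>

lemma gap_below_pseudo_frobenius:
  assumes S: "numerical_semigroup S" and x: "x \<notin> S"
  obtains s where "s \<in> S" and "x + s \<in> pseudo_frobenius S"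
proof -
  have zero: "0 \<in> S" and fin: "finite (- S)"
    and add: "\<And>a b. a \<in> S \<Longrightarrow> b \<in> S \<Longrightarrow> a + b \<in> S"
    using S by (auto simp: numerical_semigroup_def numerical_set_def)
  define B where "B = {s \<in> S. x + s \<notin> S}"
  have "(+) x ` B \<subseteq> - S" by (auto simp: B_def)
  with fin have "finite ((+) x ` B)" by (rule rev_finite_subset)
  then have finB: "finite B" by (rule finite_imageD) (simp add: inj_on_def)
  have "B \<noteq> {}" using zero x by (force simp: B_def)
  then have max: "Max B \<in> B" using finB by simp
  have "x + Max B + u \<in> S" if "u \<in> S - {0}" for u
  proof (rule ccontr)
    assume "x + Max B + u \<notin> S"
    then have "Max B + u \<in> B"
      using that max add by (simp add: B_def add.assoc)
    then have "Max B + u \<le> Max B" using Max_ge[OF finB] by blast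
    with that show False by simp
  qed
  then have "x + Max B \<in> pseudo_frobenius S"
    using max by (simp add: B_def pseudo_frobenius_def)
  moreover have "Max B \<in> S" using max by (simp add: B_def)
  ultimately show thesis using that by blast
qed

text \<open>The canonical ideal is written additively, as the subtraction in \<open>F - x \<notin> S\<close> is truncated on
  \<^typ>\<open>nat\<close>.\<close>

definition canonical_ideal :: "nat set \<Rightarrow> nat set" where
  "canonical_ideal S = {x. \<forall>s\<in>S. x + s \<noteq> Max (- S)}"

context
  fixes S :: "nat set"
  assumes S: "numerical_semigroup S" and proper: "S \<noteq> UNIV"
begin

lemma zero_mem: "0 \<in> S"
  and finite_gaps: "finite (- S)"
  and add_mem: "a \<in> S \<Longrightarrow> b \<in> S \<Longrightarrow> a + b \<in> S"
  using S by (auto simp: numerical_semigroup_def numerical_set_def)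

lemma frobenius_not_mem: "Max (- S) \<notin> S"
  using Max_in[OF finite_gaps] proper by auto

lemma above_frobenius_mem: "Max (- S) < x \<Longrightarrow> x \<in> S"
  using Max_ge[OF finite_gaps, of x] by force

lemma frobenius_pseudo_frobenius: "Max (- S) \<in> pseudo_frobenius S"
  using frobenius_not_mem above_frobenius_mem by (simp add: pseudo_frobenius_def)

lemma numerical_set_canonical_ideal: "numerical_set (canonical_ideal S)"
proof -
  have "- canonical_ideal S \<subseteq> {..Max (- S)}" by (auto simp: canonical_ideal_def)
  then have "finite (- canonical_ideal S)" by (rule finite_subset) simp
  then show ?thesis
    using frobenius_not_mem by (auto simp: numerical_set_def canonical_ideal_def)
qed

text \<open>A gap \<open>x\<close> cannot stabilise the ideal: \<open>Max (- S) - x\<close> lies in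
  it, but its translate by \<open>x\<close> is \<open>Max (- S)\<close>, which does not.\<close>

lemma atom_monoid_canonical_ideal: "atom_monoid (canonical_ideal S) = S"
proof (intro equalityI subsetI)
  fix x assume x: "x \<in> atom_monoid (canonical_ideal S)"
  show "x \<in> S"
  proof (rule ccontr)
    assume "x \<notin> S"
    then have le: "x \<le> Max (- S)" using above_frobenius_mem not_less by blast
    have "Max (- S) - x + s \<noteq> Max (- S)" if "s \<in> S" for s
      using that le \<open>x \<notin> S\<close> by (cases "s = x") auto
    then have "Max (- S) - x \<in> canonical_ideal S" by (simp add: canonical_ideal_def)
    with x have "x + (Max (- S) - x) \<in> canonical_ideal S" by (auto simp: atom_monoid_iff)
    with le zero_mem show False by (auto simp: canonical_ideal_def)
  qed
next
  fix x assume "x \<in> S"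
  then show "x \<in> atom_monoid (canonical_ideal S)"
    using add_mem[of x] by (fastforce simp: atom_monoid_iff canonical_ideal_def ac_simps)
qed

lemma pseudo_frobenius_mem_canonical_ideal:
  assumes "p \<in> pseudo_frobenius S" and "p \<noteq> Max (- S)"
  shows "p \<in> canonical_ideal S"
  unfolding canonical_ideal_def
proof safe
  fix s assume "s \<in> S" and eq: "p + s = Max (- S)"
  then have "s \<noteq> 0" using assms(2) by auto
  with assms(1) \<open>s \<in> S\<close> have "p + s \<in> S" by (simp add: pseudo_frobenius_def)
  with eq frobenius_not_mem show False by simp
qed

context
  fixes T :: "nat set"
  assumes zero_T: "0 \<in> T" and atom_T: "atom_monoid T = S"
begin

lemma associated_add_mem: "s \<in> S \<Longrightarrow> t \<in> T \<Longrightarrow> s + t \<in> T"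
  using atom_T atom_monoid_iff by blast

lemma subset_associated: "S \<subseteq> T"
  using associated_add_mem[OF _ zero_T] by auto

text \<open>Otherwise \<open>Max (- S)\<close> would translate \<open>T\<close> into itself, since
  every larger number is in \<open>S\<close>, and so would belong to \<open>S\<close>.\<close>

lemma frobenius_not_mem_associated: "Max (- S) \<notin> T"
proof
  assume F: "Max (- S) \<in> T"
  have "Max (- S) + t \<in> T" for t
    using F above_frobenius_mem[of "Max (- S) + t"] subset_associated by (cases "t = 0") auto
  then show False
    using atom_T frobenius_not_mem by (auto simp: atom_monoid_iff)
qed

lemma associated_subset_canonical_ideal: "T \<subseteq> canonical_ideal S"
  using associated_add_mem frobenius_not_mem_associated
  by (fastforce simp: canonical_ideal_def add.commute)

lemma associated_cases:
  assumes PF: "pseudo_frobenius S = {P, Max (- S)}"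
  shows "T = S \<or> T = canonical_ideal S"
proof (cases "T = S")
  case False
  then obtain t where t: "t \<in> T" "t \<notin> S" using subset_associated by auto
  obtain s where s: "s \<in> S" "t + s \<in> {P, Max (- S)}"
    using gap_below_pseudo_frobenius[OF S t(2)] PF by metis
  have "t + s \<in> T" using associated_add_mem[OF s(1) t(1)] by (simp add: add.commute)
  then have PT: "P \<in> T" using s(2) frobenius_not_mem_associated by auto
  have P: "P \<notin> S"
    using PF by (auto simp: pseudo_frobenius_def set_eq_iff)
  obtain u where u: "u \<in> T" "P + u \<notin> T"
    using P atom_T atom_monoid_iff by blast
  then have "u \<noteq> 0" and "P + u \<notin> S" using PT subset_associated by (metis add_0_right, blast)
  \<comment> \<open>The alternative \<open>P + u + v = P\<close> is excluded by
    \<open>u \<noteq> 0\<close>.\<close>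
  then obtain v where v: "v \<in> S" "P + u + v = Max (- S)"
    using gap_below_pseudo_frobenius[OF S \<open>P + u \<notin> S\<close>] PF by auto
  have gen: "v + u \<in> T" using associated_add_mem[OF v(1) u(1)] .
  have "k \<in> T" if k: "k \<in> canonical_ideal S" for k
  proof (cases "k \<le> Max (- S)")
    case False
    then show ?thesis using above_frobenius_mem subset_associated by auto
  next
    case True
    then have "Max (- S) - k \<notin> S" using k by (auto simp: canonical_ideal_def)
    then obtain w where w: "w \<in> S" "Max (- S) - k + w \<in> {P, Max (- S)}"
      using gap_below_pseudo_frobenius[OF S] PF by metis
    \<comment> \<open>Here \<open>v + u\<close> is \<open>Max (- S) - P\<close>, so the two
      pseudo-Frobenius values give the two forms of \<open>k\<close>.\<close>
    then have "k = w + (v + u) \<or> k = w" using True v(2) by auto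
    then show ?thesis
      using associated_add_mem[OF w(1) gen] w(1) subset_associated by auto
  qed
  then show ?thesis using associated_subset_canonical_ideal by auto
qed simp

end

end

theorem theorem2p5:
  fixes S :: "nat set"
  assumes "numerical_semigroup S"
    and "semigroup_type S = 2"
  shows "num_associated_sets S = 2"
proof -
  note S = assms(1)
  have card: "card (pseudo_frobenius S) = 2" using assms(2) by (simp add: semigroup_type_def)
  \<comment> \<open>\<open>UNIV\<close> has no gaps, hence type 0.\<close>
  then have proper: "S \<noteq> UNIV" by (auto simp: pseudo_frobenius_def)
  obtain P where PF: "pseudo_frobenius S = {P, Max (- S)}" and ne: "P \<noteq> Max (- S)"
    using card frobenius_pseudo_frobenius[OF S proper] by (fastforce simp: card_2_iff)
  have "P \<in> canonical_ideal S"
    using pseudo_frobenius_mem_canonical_ideal[OF S proper _ ne] PF by simp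
  moreover have "P \<notin> S" using PF by (auto simp: pseudo_frobenius_def set_eq_iff)
  ultimately have K: "S \<noteq> canonical_ideal S" by blast
  have "associated_numerical_sets S = {S, canonical_ideal S}"
  proof
    show "associated_numerical_sets S \<subseteq> {S, canonical_ideal S}"
      using associated_cases[OF S proper _ _ PF]
      by (auto simp: associated_numerical_sets_def numerical_set_def)
    show "{S, canonical_ideal S} \<subseteq> associated_numerical_sets S"
      using S atom_monoid_semigroup[OF S] numerical_set_canonical_ideal[OF S proper]
        atom_monoid_canonical_ideal[OF S proper]
      by (auto simp: associated_numerical_sets_def numerical_semigroup_def)
  qed
  with K show ?thesis by (simp add: num_associated_sets_def)
qed

end
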